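(* Let $S$ be a subtractive semiring and let $\Lambda,\Delta$ be two index sets such that either $\Lambda$ or $\Delta$ is nonempty. Then for all natural numbers $n\ge 1$, $\operatorname{zd}(S[X_\Lambda,{X_\Delta}^{-1}])=n$ if and only if $\operatorname{zd}(S)=n$ and $S$ has Property (A).
   Context: A semiring $(S,+,\cdot,0,1)$ is commutative: $(S,+,0)$ and $(S,\cdot,1)$ are commutative monoids, $1\neq 0$, multiplication distributes over addition, and $s\cdot 0=0$ for all $s$. An ideal is a nonempty subset closed under addition and under multiplication by elements of $S$. A prime ideal is an ideal $P\neq S$ such that $ab\in P$ implies $a\in P$ or $b\in P$. An ideal $I$ is subtractive if $a+b\in I$ and $a\in I$ imply $b\in I$; $S$ is subtractive if all its ideals are. $Z(S)$ is the set of zero-divisors: $s\in S$ with $ss'=0$ for some $s'\ne 0$ in $S$. $S$ has Property (A) if each finitely generated ideal $I\subseteq Z(S)$ has a nonzero annihilator, i.e. there is $s\ne 0$ in $S$ with $sI=0$. For a semiring $R$, $\operatorname{zd}(R)=n$ means that $R$ has few zero-divisors of degree $n$: $Z(R)=\bigcup_{i=1}^n\mathbf{p}_i$ for prime ideals $\mathbf{p}_1,\ldots,\mathbf{p}_n$ of $R$ with $\mathbf{p}_i\nsubseteq\bigcup_{j\ne i}\mathbf{p}_j$ for all $i$ (when all prime ideals of $R$ are subtractive these primes are uniquely determined and are the maximal primes of $Z(R)$). $S[X_\Lambda,{X_\Delta}^{-1}]$ is the union of all the Laurent polynomial semirings $S[X_{\lambda_1},\ldots,X_{\lambda_k},{X_{\delta_1}}^{-1},\ldots,{X_{\delta_m}}^{-1}]$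 with $\lambda_i\in\Lambda$, $\delta_j\in\Delta$, i.e. the subsemiring generated by $S$, the $X_\lambda$ ($\lambda\in\Lambda$) and the $X_\delta^{-1}$ ($\delta\in\Delta$) inside the Laurent polynomials over $S$ in commuting indeterminates indexed by $\Lambda\cup\Delta$. *)

theory Defs
  imports "HOL-Library.Poly_Mapping"
begin

text \<open>
  The class \<open>comm_semiring_1\<close> is the class of commutative semirings with an absorbing zero
  and with \<open>1 \<noteq> 0\<close>. The ring-theoretic notions below are relative to a subsemiring \<open>R\<close>,
  given as a set, so that they apply both to a whole type (\<open>R = UNIV\<close>) and to a proper
  subsemiring; they are only meaningful if \<open>R\<close> is indeed a subsemiring.
\<close>

definition is_ideal :: "'a::comm_semiring_1 set \<Rightarrow> 'a set \<Rightarrow> bool" where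
  "is_ideal R I \<longleftrightarrow> I \<subseteq> R \<and> I \<noteq> {} \<and> (\<forall>a\<in>I. \<forall>b\<in>I. a + b \<in> I) \<and> (\<forall>s\<in>R. \<forall>a\<in>I. s * a \<in> I)"

definition is_prime_ideal :: "'a::comm_semiring_1 set \<Rightarrow> 'a set \<Rightarrow> bool" where
  "is_prime_ideal R P \<longleftrightarrow>
     is_ideal R P \<and> P \<noteq> R \<and> (\<forall>a\<in>R. \<forall>b\<in>R. a * b \<in> P \<longrightarrow> a \<in> P \<or> b \<in> P)"

definition subtractive_ideal :: "'a::comm_semiring_1 set \<Rightarrow> 'a set \<Rightarrow> bool" where
  "subtractive_ideal R I \<longleftrightarrow>
     is_ideal R I \<and> (\<forall>a\<in>R. \<forall>b\<in>R. a + b \<in> I \<longrightarrow> a \<in> I \<longrightarrow> b \<in> I)"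

definition subtractive_semiring :: "'a::comm_semiring_1 set \<Rightarrow> bool" where
  "subtractive_semiring R \<longleftrightarrow> (\<forall>I. is_ideal R I \<longrightarrow> subtractive_ideal R I)"

definition zero_divisors :: "'a::comm_semiring_1 set \<Rightarrow> 'a set" where
  "zero_divisors R = {s \<in> R. \<exists>t\<in>R. t \<noteq> 0 \<and> s * t = 0}"

definition ideal_generated :: "'a::comm_semiring_1 set \<Rightarrow> 'a set \<Rightarrow> 'a set" where
  "ideal_generated R F = \<Inter> {I. is_ideal R I \<and> F \<subseteq> I}"

definition property_A :: "'a::comm_semiring_1 set \<Rightarrow> bool" where
  "property_A R \<longleftrightarrow>
     (\<forall>F. finite F \<and> F \<subseteq> R \<and> ideal_generated R F \<subseteq> zero_divisors R \<longrightarrow>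
        (\<exists>s\<in>R. s \<noteq> 0 \<and> (\<forall>a \<in> ideal_generated R F. s * a = 0)))"

text \<open>
  The relation \<open>zd(R) = n\<close>. It is a relation rather than a function: no uniqueness of \<open>n\<close>
  is built in.
\<close>

definition few_zero_divisors_degree :: "'a::comm_semiring_1 set \<Rightarrow> nat \<Rightarrow> bool" where
  "few_zero_divisors_degree R n \<longleftrightarrow>
     (\<exists>p :: nat \<Rightarrow> 'a set.
        (\<forall>i\<in>{1..n}. is_prime_ideal R (p i)) \<and>
        zero_divisors R = (\<Union>i\<in>{1..n}. p i) \<and>
        (\<forall>i\<in>{1..n}. \<not> p i \<subseteq> (\<Union>j\<in>{1..n} - {i}. p j)))"

inductive_set subsemiring_generated :: "'a::comm_semiring_1 set \<Rightarrow> 'a set"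
  for G :: "'a set" where
  generator: "a \<in> G \<Longrightarrow> a \<in> subsemiring_generated G"
| zero: "0 \<in> subsemiring_generated G"
| one: "1 \<in> subsemiring_generated G"
| add: "a \<in> subsemiring_generated G \<Longrightarrow> b \<in> subsemiring_generated G \<Longrightarrow>
    a + b \<in> subsemiring_generated G"
| mult: "a \<in> subsemiring_generated G \<Longrightarrow> b \<in> subsemiring_generated G \<Longrightarrow>
    a * b \<in> subsemiring_generated G"

text \<open>
  Laurent polynomials over \<open>'s\<close> in indeterminates indexed by \<open>'i\<close>: finitely supported functions
  from exponent vectors (finitely supported functions \<open>'i \<Rightarrow> int\<close>) to coefficients, with the
  convolution product.
\<close>

type_synonym ('i, 's) laurent_poly = "('i \<Rightarrow>\<^sub>0 int) \<Rightarrow>\<^sub>0 's"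

definition laurent_const :: "'s::comm_semiring_1 \<Rightarrow> ('i, 's) laurent_poly" where
  "laurent_const s = Poly_Mapping.single 0 s"

definition laurent_var :: "'i \<Rightarrow> ('i, 's::comm_semiring_1) laurent_poly" where
  "laurent_var i = Poly_Mapping.single (Poly_Mapping.single i 1) 1"

definition laurent_var_inv :: "'i \<Rightarrow> ('i, 's::comm_semiring_1) laurent_poly" where
  "laurent_var_inv i = Poly_Mapping.single (Poly_Mapping.single i (- 1)) 1"

text \<open>
  An index in \<open>\<Delta>\<close> but not in \<open>\<Lambda>\<close> contributes only the inverse of its indeterminate. Indices
  outside \<open>\<Lambda> \<union> \<Delta>\<close> do not occur at all, so the choice of the ambient type \<open>'i\<close> is immaterial.
\<close>

definition laurent_semiring :: "'i set \<Rightarrow> 'i set \<Rightarrow> ('i, 's::comm_semiring_1) laurent_poly set" where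
  "laurent_semiring \<Lambda> \<Delta> =
     subsemiring_generated (range laurent_const \<union> laurent_var ` \<Lambda> \<union> laurent_var_inv ` \<Delta>)"

lemma laurent_var_mult_inv: "laurent_var i * laurent_var_inv i = 1"
  by (simp add: laurent_var_def laurent_var_inv_def mult_single flip: single_add)

end

theory Submission
  imports Defs "HOL.Modules"
begin

text \<open>
  Write \<open>R\<close> for the Laurent semiring. The bridge between \<open>R\<close> and the coefficient semiring
  \<open>S\<close> is McCoy's theorem (\<open>mccoy\<close>): a zero-divisor \<open>f\<close> of \<open>R\<close> is annihilated by a
  single nonzero constant \<open>s\<close>. Hence all coefficients of \<open>f\<close> lie in the ideal
  \<open>annihilator s\<close>, which is contained in \<open>Z(S)\<close>. Whenever \<open>Z(S)\<close> is a finite union of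
  primes, prime avoidance in \<open>S\<close> (\<open>prime_avoidance\<close>), available because \<open>S\<close> is
  subtractive, puts this annihilator inside a single one of them. Ideals of \<open>R\<close> itself need not
  be subtractive, so every use of prime avoidance is carried out in \<open>S\<close>.

  If \<open>Z(S)\<close> is an irredundant union of primes \<open>p\<^sub>i\<close> and Property (A) holds, then
  \<open>Z(R)\<close> is the union of the extended ideals \<open>E\<^sub>i\<close>, those of the Laurent polynomials in
  \<open>R\<close> with all coefficients in \<open>p\<^sub>i\<close>. The previous paragraph gives one inclusion and
  Property (A), applied to the ideal of coefficients, the other. The \<open>E\<^sub>i\<close> are prime by the
  argument of Gauss's lemma (\<open>is_prime_ideal_extended_ideal\<close>), and they contract to the
  \<open>p\<^sub>i\<close>, so the union remains irredundant.

  Conversely, let \<open>Z(R)\<close> be an irredundant union of primes \<open>Q\<^sub>i\<close>, with contractions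
  \<open>p\<^sub>i\<close> to \<open>S\<close>. Then \<open>Z(S)\<close> is the union of the \<open>p\<^sub>i\<close>. A finitely generated
  ideal inside \<open>Z(S)\<close> lies in some \<open>p\<^sub>i\<close>; distributing its generators over distinct
  monomials of \<open>R\<close> gives an element of \<open>Q\<^sub>i\<close>, hence a zero-divisor, and McCoy's theorem
  yields a common annihilator of the generators. If the union of the \<open>p\<^sub>i\<close> were redundant, then
  \<open>p\<^sub>i\<close> would lie in \<open>p\<^sub>j\<close> for some \<open>j \<noteq> i\<close>. By irredundancy some \<open>f \<in> Q\<^sub>i\<close>
  lies in no other \<open>Q\<^sub>k\<close>; being a zero-divisor, it has all its coefficients in some \<open>p\<^sub>k\<close> and therefore lies in
  \<open>Q\<^sub>k\<close>; so \<open>k = i\<close>, and then \<open>f\<close> lies in \<open>Q\<^sub>j\<close> as well, which is impossible.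
\<close>

section \<open>Prime avoidance\<close>

lemma is_ideal_zero:
  assumes "is_ideal R I" "0 \<in> R"
  shows "0 \<in> I"
proof -
  obtain a where "a \<in> I" using assms(1) unfolding is_ideal_def by blast
  then have "0 * a \<in> I" using assms unfolding is_ideal_def by blast
  then show ?thesis by simp
qed

lemma is_ideal_sum:
  assumes "is_ideal R I" "0 \<in> R" "\<And>x. x \<in> A \<Longrightarrow> g x \<in> I"
  shows "sum g A \<in> I"
  using assms(3)
proof (induction A rule: infinite_finite_induct)
  case (insert x A)
  then show ?case using assms(1) by (simp add: is_ideal_def)
qed (simp_all add: is_ideal_zero[OF assms(1,2)])

lemma is_ideal_prod:
  assumes "is_ideal UNIV I" "finite A" "x \<in> A" "g x \<in> I"
  shows "prod g A \<in> I"
proof -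
  have "prod g A = prod g (A - {x}) * g x"
    using assms(2,3) by (simp add: prod.remove mult.commute)
  then show ?thesis using assms(1,4) by (simp add: is_ideal_def)
qed

lemma is_prime_ideal_one:
  assumes "is_prime_ideal R P"
  shows "1 \<notin> P"
proof
  assume "1 \<in> P"
  then have "s \<in> P" if "s \<in> R" for s
    using assms that unfolding is_prime_ideal_def is_ideal_def by (metis mult.right_neutral)
  then show False using assms unfolding is_prime_ideal_def is_ideal_def by blast
qed

lemma is_prime_ideal_prod:
  assumes "is_prime_ideal UNIV P" "prod g A \<in> P"
  shows "\<exists>x\<in>A. g x \<in> P"
  using assms(2)
proof (induction A rule: infinite_finite_induct)
  case (insert x A)
  then show ?case using assms(1) by (auto simp: is_prime_ideal_def)
qed (use is_prime_ideal_one[OF assms(1)] in simp_all)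

text \<open>
  After shrinking \<open>J\<close> until no prime can be dropped from the cover, some \<open>x\<^sub>k \<in> I\<close> lies in
  \<open>p\<^sub>k\<close> only, for each \<open>k \<in> J\<close>. If at least two primes are left, \<open>x\<^sub>k\<close> plus the product of
  the other \<open>x\<^sub>j\<close> is an element of \<open>I\<close> that lies in no \<open>p\<^sub>m\<close>: exactly one of the two
  summands is in \<open>p\<^sub>m\<close>, and a subtractive ideal containing a sum and one summand contains
  the other summand.
\<close>

lemma prime_avoidance:
  assumes "finite J" "is_ideal UNIV I" "I \<subseteq> (\<Union>j\<in>J. p j)"
    and "\<And>j. j \<in> J \<Longrightarrow> is_prime_ideal UNIV (p j)"
    and "\<And>j. j \<in> J \<Longrightarrow> subtractive_ideal UNIV (p j)"
  shows "\<exists>j\<in>J. I \<subseteq> p j"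
  using assms(1,3-)
proof (induction J rule: finite_psubset_induct)
  case (psubset J)
  show ?case
  proof (cases "\<exists>k\<in>J. I \<subseteq> (\<Union>j\<in>J - {k}. p j)")
    case True
    then obtain k where k: "k \<in> J" "I \<subseteq> (\<Union>j\<in>J - {k}. p j)" by blast
    have "\<exists>j\<in>J - {k}. I \<subseteq> p j"
      by (rule psubset.IH) (use k psubset.prems in auto)
    then show ?thesis by blast
  next
    case False
    then have "\<forall>k\<in>J. \<exists>x. x \<in> I \<and> x \<notin> (\<Union>j\<in>J - {k}. p j)" by blast
    then obtain x where x: "\<And>k. k \<in> J \<Longrightarrow> x k \<in> I"
      "\<And>k j. k \<in> J \<Longrightarrow> j \<in> J \<Longrightarrow> j \<noteq> k \<Longrightarrow> x k \<notin> p j"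
      by (metis DiffI UN_I singletonD)
    have own: "x k \<in> p k" if "k \<in> J" for k using x[OF that] psubset.prems(1) by blast
    have "I \<noteq> {}" using assms(2) by (simp add: is_ideal_def)
    then obtain k where k: "k \<in> J" using psubset.prems(1) by blast
    show ?thesis
    proof (cases "J = {k}")
      case True
      then show ?thesis using psubset.prems(1) by simp
    next
      case False
      then obtain l where l: "l \<in> J - {k}" using k by blast
      let ?y = "prod x (J - {k})"
      have "?y \<in> I" using assms(2) psubset.hyps l x(1) by (intro is_ideal_prod[of _ _ l]) auto
      then have "x k + ?y \<in> I" using assms(2) x(1) k by (simp add: is_ideal_def)
      then obtain m where m: "m \<in> J" "x k + ?y \<in> p m" using psubset.prems(1) by blast
      have False
      proof (cases "m = k")
        case True
        then have "?y \<in> p k"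
          using own[OF k] m psubset.prems(3)[OF k] unfolding subtractive_ideal_def by blast
        then obtain j where "j \<in> J - {k}" "x j \<in> p k"
          using is_prime_ideal_prod psubset.prems(2)[OF k] by blast
        then show False using x(2) k by blast
      next
        case False
        have sub: "subtractive_ideal UNIV (p m)" using psubset.prems(3) m(1) .
        then have "?y \<in> p m"
          using False m(1) own psubset.hyps
          by (intro is_ideal_prod[of _ _ m]) (auto simp: subtractive_ideal_def)
        then have "x k \<in> p m"
          using sub m(2) unfolding subtractive_ideal_def by (metis UNIV_I add.commute)
        then show False using x(2)[OF k m(1) False] by blast
      qed
      then show ?thesis ..
    qed
  qed
qed

section \<open>Annihilators and generated ideals\<close>

definition annihilator :: "'a::comm_semiring_1 \<Rightarrow> 'a set" where
  "annihilator s = {x. s * x = 0}"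

lemma is_ideal_annihilator: "is_ideal UNIV (annihilator s)"
  by (auto simp: is_ideal_def annihilator_def distrib_left mult.left_commute intro: exI[of _ 0])

lemma annihilator_subset_zero_divisors: "s \<noteq> 0 \<Longrightarrow> annihilator s \<subseteq> zero_divisors UNIV"
  by (auto simp: annihilator_def zero_divisors_def mult.commute)

lemma ideal_generated_subset: "is_ideal R I \<Longrightarrow> F \<subseteq> I \<Longrightarrow> ideal_generated R F \<subseteq> I"
  by (auto simp: ideal_generated_def)

lemma subset_ideal_generated: "F \<subseteq> ideal_generated R F"
  by (auto simp: ideal_generated_def)

lemma is_ideal_ideal_generated: "is_ideal UNIV (ideal_generated UNIV F)"
  unfolding is_ideal_def
proof (intro conjI ballI)
  have "0 \<in> ideal_generated UNIV F"
    by (auto simp: ideal_generated_def intro: is_ideal_zero)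
  then show "ideal_generated UNIV F \<noteq> {}" by blast
qed (auto simp: ideal_generated_def is_ideal_def)

section \<open>Products of Laurent polynomials\<close>

abbreviation lookup :: "('a \<Rightarrow>\<^sub>0 'b::zero) \<Rightarrow> 'a \<Rightarrow> 'b" where
  "lookup \<equiv> Poly_Mapping.lookup"

abbreviation keys :: "('a \<Rightarrow>\<^sub>0 'b::zero) \<Rightarrow> 'a set" where
  "keys \<equiv> Poly_Mapping.keys"

lemma sum_monomials:
  "(\<Sum>e\<in>keys f. Poly_Mapping.single e (lookup f e)) = f"
  by (intro poly_mapping_eqI) (simp add: lookup_sum lookup_single when_def in_keys_iff)

lemma times_conv_sum_monomials:
  fixes f g :: "('i, 's::comm_semiring_1) laurent_poly"
  shows "f * g = (\<Sum>a\<in>keys f. \<Sum>b\<in>keys g. Poly_Mapping.single (a + b) (lookup f a * lookup g b))"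
proof -
  have "f * g = (\<Sum>a\<in>keys f. Poly_Mapping.single a (lookup f a)) *
      (\<Sum>b\<in>keys g. Poly_Mapping.single b (lookup g b))"
    by (simp add: sum_monomials)
  then show ?thesis by (simp add: sum_product mult_single)
qed

lemma lookup_times:
  fixes f g :: "('i, 's::comm_semiring_1) laurent_poly"
  shows "lookup (f * g) e =
    (\<Sum>(a, b)\<in>keys f \<times> keys g. lookup f a * lookup g b when a + b = e)"
  by (simp add: times_conv_sum_monomials lookup_sum lookup_single sum.cartesian_product split_def)

lemma lookup_laurent_const: "lookup (laurent_const s) e = (s when e = 0)"
  by (auto simp: laurent_const_def lookup_single when_def)

lemma lookup_laurent_const_times [simp]:
  "lookup (laurent_const s * f) e = s * lookup f e"
proof -
  have "laurent_const s * f = (\<Sum>a\<in>keys f. Poly_Mapping.single a (s * lookup f a))"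
    by (subst (1) sum_monomials[symmetric])
      (simp add: laurent_const_def sum_distrib_left mult_single)
  then have "lookup (laurent_const s * f) e = (\<Sum>a\<in>keys f. if a = e then s * lookup f a else 0)"
    by (simp add: lookup_sum lookup_single when_def)
  then show ?thesis by (auto simp: sum.delta in_keys_iff)
qed

text \<open>
  The exponent group carries no canonical linear order, but leading terms only require comparing
  finitely many exponents. An additive map to the integers that separates them serves as a generic
  weight. It is built by induction on \<open>D\<close>: if the current weight \<open>\<phi>\<close> vanishes on the new
  vector \<open>d\<close>, perturb a large multiple of \<open>\<phi>\<close> by a coordinate on which \<open>d\<close> does not
  vanish.
\<close>

lemma additive_functional_nonzero_on:
  fixes D :: "('i \<Rightarrow>\<^sub>0 int) set"
  assumes "finite D" "0 \<notin> D"
  shows "\<exists>\<phi>::('i \<Rightarrow>\<^sub>0 int) \<Rightarrow> int. additive \<phi> \<and> (\<forall>d\<in>D. \<phi> d \<noteq> 0)"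
  using assms
proof (induction D)
  case empty
  show ?case by (intro exI[of _ "\<lambda>_. 0"]) (simp add: additive_def)
next
  case (insert d D)
  then obtain \<phi> :: "('i \<Rightarrow>\<^sub>0 int) \<Rightarrow> int" where \<phi>: "additive \<phi>" "\<forall>d\<in>D. \<phi> d \<noteq> 0" by auto
  show ?case
  proof (cases "\<phi> d = 0")
    case False
    then show ?thesis using \<phi> by blast
  next
    case True
    from insert.prems obtain i where i: "lookup d i \<noteq> 0"
      by (metis insertI1 poly_mapping_eqI lookup_zero)
    \<comment> \<open>\<open>M\<close> exceeds every coordinate \<open>\<bar>lookup c i\<bar>\<close>, so the perturbation cannot cancel
      \<open>M * \<phi> c\<close>, which has absolute value at least \<open>M\<close>.\<close>
    define M where "M = 1 + (\<Sum>c\<in>D. \<bar>lookup c i\<bar>)"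
    define \<psi> where "\<psi> c = M * \<phi> c + lookup c i" for c
    have M: "\<bar>lookup c i\<bar> < M" if "c \<in> D" for c
      using member_le_sum[of c D "\<lambda>c. \<bar>lookup c i\<bar>"] that insert.hyps(1) by (simp add: M_def)
    have "\<psi> c \<noteq> 0" if c: "c \<in> D" for c
    proof
      assume "\<psi> c = 0"
      then have "\<bar>lookup c i\<bar> = \<bar>M\<bar> * \<bar>\<phi> c\<bar>" by (simp add: \<psi>_def flip: abs_mult)
      moreover have "\<bar>M\<bar> * 1 \<le> \<bar>M\<bar> * \<bar>\<phi> c\<bar>"
        using \<phi>(2) c by (intro mult_left_mono) fastforce+
      ultimately show False using M[OF c] by linarith
    qed
    moreover have "\<psi> d \<noteq> 0" using True i by (simp add: \<psi>_def)
    moreover have "additive \<psi>"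
      using \<phi>(1) by (simp add: additive_def \<psi>_def lookup_add algebra_simps)
    ultimately show ?thesis by blast
  qed
qed

lemma additive_functional_inj_on:
  fixes A :: "('i \<Rightarrow>\<^sub>0 int) set"
  assumes "finite A"
  shows "\<exists>\<phi>::('i \<Rightarrow>\<^sub>0 int) \<Rightarrow> int. additive \<phi> \<and> inj_on \<phi> A"
proof -
  have "finite ((\<lambda>(a, b). a - b) ` (A \<times> A) - {0})" using assms by simp
  then obtain \<phi> :: "('i \<Rightarrow>\<^sub>0 int) \<Rightarrow> int"
    where \<phi>: "additive \<phi>" "\<And>d. d \<in> (\<lambda>(a, b). a - b) ` (A \<times> A) - {0} \<Longrightarrow> \<phi> d \<noteq> 0"
    using additive_functional_nonzero_on by (metis (lifting) Diff_iff singletonI)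
  have "a = b" if "a \<in> A" "b \<in> A" "\<phi> a = \<phi> b" for a b
  proof (rule ccontr)
    assume "a \<noteq> b"
    then have "\<phi> (a - b) \<noteq> 0" using that by (intro \<phi>(2)) auto
    then show False using that(3) by (simp add: additive.diff[OF \<phi>(1)])
  qed
  then show ?thesis using \<phi>(1) unfolding inj_on_def by blast
qed

lemma finite_obtains_maximizer:
  fixes \<phi> :: "'a \<Rightarrow> 'b::linorder"
  assumes "finite A" "A \<noteq> {}"
  obtains a where "a \<in> A" "\<And>a'. a' \<in> A \<Longrightarrow> \<phi> a' \<le> \<phi> a"
proof -
  have "Max (\<phi> ` A) \<in> \<phi> ` A" using assms by simp
  then obtain a where "a \<in> A" "\<phi> a = Max (\<phi> ` A)" by auto
  then show ?thesis using that assms(1) by simp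
qed

text \<open>
  The common step of McCoy's theorem (with \<open>I = {0}\<close>) and Gauss's lemma (with \<open>I\<close> prime). The
  exponents \<open>a\<close> and \<open>b\<close> are the top ones modulo \<open>I\<close>: products involving a term of higher
  weight are already in \<open>I\<close>. In the coefficient of \<open>f * g\<close> at \<open>a + b\<close>, any summand other
  than the one for \<open>(a, b)\<close> must involve such a term, since \<open>\<phi>\<close> is additive and separates
  exponents. Subtractivity of \<open>I\<close> then isolates the remaining summand.
\<close>

lemma top_coefficient_in_ideal:
  fixes f g :: "('i, 's::comm_semiring_1) laurent_poly" and \<phi> :: "('i \<Rightarrow>\<^sub>0 int) \<Rightarrow> int"
  assumes I: "subtractive_ideal UNIV I"
    and \<phi>: "additive \<phi>" "inj_on \<phi> (keys f)" "inj_on \<phi> (keys g)"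
    and ab: "a \<in> keys f" "b \<in> keys g"
    and above: "\<And>a' b'. a' \<in> keys f \<Longrightarrow> b' \<in> keys g \<Longrightarrow> \<phi> a < \<phi> a' \<or> \<phi> b < \<phi> b' \<Longrightarrow>
      lookup f a' * lookup g b' \<in> I"
    and prod: "lookup (f * g) (a + b) \<in> I"
  shows "lookup f a * lookup g b \<in> I"
proof -
  let ?t = "\<lambda>(a', b'). lookup f a' * lookup g b' when a' + b' = a + b"
  let ?rest = "sum ?t (keys f \<times> keys g - {(a, b)})"
  have ideal: "is_ideal UNIV I" using I by (simp add: subtractive_ideal_def)
  have "?rest \<in> I"
  proof (rule is_ideal_sum[OF ideal])
    fix c assume c: "c \<in> keys f \<times> keys g - {(a, b)}"
    obtain a' b' where [simp]: "c = (a', b')" by fastforce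
    show "?t c \<in> I"
    proof (cases "a' + b' = a + b")
      case True
      then have "\<phi> a' + \<phi> b' = \<phi> a + \<phi> b" using \<phi>(1) by (metis additive.add)
      moreover have "\<not> (\<phi> a' = \<phi> a \<and> \<phi> b' = \<phi> b)"
        using c ab \<phi>(2,3) by (auto dest: inj_onD)
      ultimately have "\<phi> a < \<phi> a' \<or> \<phi> b < \<phi> b'" by linarith
      then show ?thesis using True above c by simp
    qed (use is_ideal_zero[OF ideal] in simp)
  qed simp
  moreover have "lookup (f * g) (a + b) = ?t (a, b) + ?rest"
    unfolding lookup_times using ab by (intro sum.remove) auto
  ultimately show ?thesis
    using I prod by (simp add: subtractive_ideal_def add.commute[of _ ?rest])
qed

lemma subtractive_zero_ideal: "subtractive_ideal UNIV {0}"
  by (auto simp: subtractive_ideal_def is_ideal_def)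

text \<open>
  Descent on the number of terms of \<open>g\<close>. If every coefficient of \<open>f\<close> kills \<open>g\<close>, any nonzero
  coefficient of \<open>g\<close> will do. Otherwise take the coefficient \<open>c\<close> of highest weight in
  \<open>f\<close> that does not kill \<open>g\<close>. The coefficients above it contribute nothing to
  \<open>f * g\<close>, so \<open>c\<close> kills the leading coefficient of \<open>g\<close>, and \<open>c * g\<close> is a nonzero
  annihilator of \<open>f\<close> with fewer terms.
\<close>

lemma mccoy:
  fixes f g :: "('i, 's::comm_semiring_1) laurent_poly"
  assumes "f * g = 0" "g \<noteq> 0"
  shows "\<exists>s. s \<noteq> 0 \<and> (\<forall>e. s * lookup f e = 0)"
proof -
  obtain \<phi> :: "('i \<Rightarrow>\<^sub>0 int) \<Rightarrow> int" where \<phi>: "additive \<phi>" "inj_on \<phi> (keys f \<union> keys g)"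
    using additive_functional_inj_on[of "keys f \<union> keys g"] by auto
  then have "inj_on \<phi> (keys f)" "inj_on \<phi> (keys g)" by (auto intro: inj_on_subset)
  from assms this(2) show ?thesis
  proof (induction "card (keys g)" arbitrary: g rule: less_induct)
    case less
    define A where "A = {a \<in> keys f. laurent_const (lookup f a) * g \<noteq> 0}"
    show ?case
    proof (cases "A = {}")
      case True
      obtain b where b: "lookup g b \<noteq> 0"
        using less.prems(2) by (metis poly_mapping_eqI lookup_zero)
      have "lookup f a * lookup g b = 0" for a
      proof (cases "a \<in> keys f")
        case True
        then have "laurent_const (lookup f a) * g = 0" using \<open>A = {}\<close> by (auto simp: A_def)
        then show ?thesis by (metis lookup_laurent_const_times lookup_zero)
      qed (simp add: in_keys_iff)
      then show ?thesis using b by (metis mult.commute)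
    next
      case False
      have "finite A" by (simp add: A_def)
      then obtain a where a: "a \<in> A" "\<And>a'. a' \<in> A \<Longrightarrow> \<phi> a' \<le> \<phi> a"
        using False finite_obtains_maximizer[of A \<phi>] by blast
      have "keys g \<noteq> {}" using less.prems(2) by simp
      then obtain b where b: "b \<in> keys g" "\<And>b'. b' \<in> keys g \<Longrightarrow> \<phi> b' \<le> \<phi> b"
        using finite_obtains_maximizer[OF finite_keys, of g \<phi>] by blast
      have "lookup f a * lookup g b \<in> {0}"
      proof (rule top_coefficient_in_ideal[OF subtractive_zero_ideal \<phi>(1) \<open>inj_on \<phi> (keys f)\<close> less.prems(3)])
        fix a' b' assume ab': "a' \<in> keys f" "b' \<in> keys g" "\<phi> a < \<phi> a' \<or> \<phi> b < \<phi> b'"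
        then have "a' \<notin> A" using a(2) b(2) by fastforce
        then have "laurent_const (lookup f a') * g = 0" using ab' by (simp add: A_def)
        then show "lookup f a' * lookup g b' \<in> {0}"
          by (metis lookup_laurent_const_times lookup_zero singletonI)
      qed (use a(1) b(1) less.prems(1) in \<open>simp_all add: A_def\<close>)
      then have ab: "lookup f a * lookup g b = 0" by simp
      let ?h = "laurent_const (lookup f a) * g"
      have "keys ?h \<subseteq> keys g - {b}" using ab by (auto simp: in_keys_iff)
      moreover have "keys g - {b} \<subset> keys g" using b(1) by blast
      ultimately have sub: "keys ?h \<subset> keys g" by blast
      show ?thesis
      proof (rule less.hyps)
        show "card (keys ?h) < card (keys g)" using sub by (simp add: psubset_card_mono)
        show "f * ?h = 0"
          using less.prems(1) by (metis mult.left_commute mult_zero_right)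
        show "?h \<noteq> 0" using a(1) by (simp add: A_def)
        show "inj_on \<phi> (keys ?h)" using less.prems(3) sub by (auto intro: inj_on_subset)
      qed
    qed
  qed
qed

section \<open>The Laurent semiring\<close>

lemma laurent_semiring_closed:
  "0 \<in> laurent_semiring \<Lambda> \<Delta>"
  "1 \<in> laurent_semiring \<Lambda> \<Delta>"
  "f \<in> laurent_semiring \<Lambda> \<Delta> \<Longrightarrow> g \<in> laurent_semiring \<Lambda> \<Delta> \<Longrightarrow> f + g \<in> laurent_semiring \<Lambda> \<Delta>"
  "f \<in> laurent_semiring \<Lambda> \<Delta> \<Longrightarrow> g \<in> laurent_semiring \<Lambda> \<Delta> \<Longrightarrow> f * g \<in> laurent_semiring \<Lambda> \<Delta>"
  "laurent_const s \<in> laurent_semiring \<Lambda> \<Delta>"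
  by (auto simp: laurent_semiring_def intro: subsemiring_generated.intros)

text \<open>
  This replaces an explicit description of the exponents that occur in the Laurent semiring: the set
  of \<open>e\<close> whose monomial belongs to it contains the exponents of the generators and, since the
  monomials of a product are products of monomials, is respected by all operations.
\<close>

lemma monomial_in_laurent_semiring:
  fixes f :: "('i, 's::comm_semiring_1) laurent_poly"
  assumes "f \<in> laurent_semiring \<Lambda> \<Delta>" "e \<in> keys f"
  shows "Poly_Mapping.single e 1 \<in> (laurent_semiring \<Lambda> \<Delta> :: ('i, 's) laurent_poly set)"
  using assms unfolding laurent_semiring_def
proof (induction arbitrary: e)
  case (generator f)
  consider s where "f = laurent_const s" | i where "i \<in> \<Lambda>" "f = laurent_var i"
    | i where "i \<in> \<Delta>" "f = laurent_var_inv i"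
    using generator.hyps by blast
  then show ?case
  proof cases
    case 1
    then have "e = 0" using generator.prems by (auto simp: laurent_const_def split: if_splits)
    then show ?thesis using subsemiring_generated.one by simp
  next
    case 2
    then have "Poly_Mapping.single e 1 = f"
      using generator.prems by (auto simp: laurent_var_def split: if_splits)
    then show ?thesis using subsemiring_generated.generator[OF generator.hyps] by simp
  next
    case 3
    then have "Poly_Mapping.single e 1 = f"
      using generator.prems by (auto simp: laurent_var_inv_def split: if_splits)
    then show ?thesis using subsemiring_generated.generator[OF generator.hyps] by simp
  qed
next
  case (add f g)
  then show ?case using Poly_Mapping.keys_add[of f g] by blast
next
  case (mult f g)
  obtain a b where ab: "a \<in> keys f" "b \<in> keys g" "e = a + b"
    using keys_mult[of f g] mult.prems by blast
  then have "Poly_Mapping.single e 1 =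
      Poly_Mapping.single a 1 * (Poly_Mapping.single b 1 :: ('i, 's) laurent_poly)"
    by (simp add: mult_single)
  then show ?case using mult.IH ab subsemiring_generated.mult by metis
next
  case one
  then show ?case using subsemiring_generated.one by auto
qed simp_all

lemma zero_divisors_laurent_semiring:
  fixes f :: "('i, 's::comm_semiring_1) laurent_poly"
  shows "f \<in> zero_divisors (laurent_semiring \<Lambda> \<Delta>) \<longleftrightarrow>
    f \<in> laurent_semiring \<Lambda> \<Delta> \<and> (\<exists>s. s \<noteq> 0 \<and> range (lookup f) \<subseteq> annihilator s)"
proof -
  have "f * laurent_const s = 0" "laurent_const s \<noteq> (0 :: ('i, 's) laurent_poly)"
    if "s \<noteq> 0" "range (lookup f) \<subseteq> annihilator s" for s
  proof -
    show "f * laurent_const s = 0"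
      using that(2) by (intro poly_mapping_eqI) (auto simp: annihilator_def mult.commute[of f])
    show "laurent_const s \<noteq> (0 :: ('i, 's) laurent_poly)"
      using that(1) by (metis laurent_const_def lookup_single_eq lookup_zero)
  qed
  then show ?thesis
    using mccoy[of f] laurent_semiring_closed(5)
    by (fastforce simp: zero_divisors_def annihilator_def)
qed

lemma laurent_const_zero_divisor_iff:
  "(laurent_const s :: ('i, 's::comm_semiring_1) laurent_poly) \<in> zero_divisors (laurent_semiring \<Lambda> \<Delta>)
    \<longleftrightarrow> s \<in> zero_divisors UNIV"
proof -
  have "range (lookup (laurent_const s :: ('i, 's) laurent_poly)) \<subseteq> annihilator t \<longleftrightarrow> s * t = 0" for t
    by (auto simp: annihilator_def lookup_laurent_const when_def mult.commute)
  then show ?thesis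
    by (auto simp: zero_divisors_laurent_semiring laurent_semiring_closed zero_divisors_def[of UNIV])
qed

text \<open>
  Such an \<open>f\<close> is a combination of elements of \<open>Q\<close> with monomial coefficients, and these
  monomials are available in the Laurent semiring because they occur in \<open>f\<close>.
\<close>

lemma coefficients_in_ideal:
  fixes Q :: "('i, 's::comm_semiring_1) laurent_poly set"
  assumes Q: "is_ideal (laurent_semiring \<Lambda> \<Delta>) Q" and f: "f \<in> laurent_semiring \<Lambda> \<Delta>"
    and coeffs: "range (lookup f) \<subseteq> laurent_const -` Q"
  shows "f \<in> Q"
proof -
  have "(\<Sum>e\<in>keys f. Poly_Mapping.single e 1 * laurent_const (lookup f e)) \<in> Q"
  proof (rule is_ideal_sum[OF Q])
    fix e assume "e \<in> keys f"
    then show "Poly_Mapping.single e 1 * laurent_const (lookup f e) \<in> Q"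
      using Q monomial_in_laurent_semiring[OF f] coeffs unfolding is_ideal_def by blast
  qed (rule laurent_semiring_closed)
  then show ?thesis
    by (simp add: laurent_const_def mult_single sum_monomials)
qed

section \<open>Extension and contraction of prime ideals\<close>

definition extended_ideal :: "'i set \<Rightarrow> 'i set \<Rightarrow> 's set \<Rightarrow> ('i, 's::comm_semiring_1) laurent_poly set" where
  "extended_ideal \<Lambda> \<Delta> I = {f \<in> laurent_semiring \<Lambda> \<Delta>. range (lookup f) \<subseteq> I}"

lemma laurent_const_in_extended_ideal_iff:
  assumes "is_ideal UNIV I"
  shows "(laurent_const s :: ('i, 's::comm_semiring_1) laurent_poly) \<in> extended_ideal \<Lambda> \<Delta> I \<longleftrightarrow> s \<in> I"
  using is_ideal_zero[OF assms] laurent_semiring_closed(5)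
  by (auto simp: extended_ideal_def lookup_laurent_const when_def)

lemma is_ideal_extended_ideal:
  assumes "is_ideal UNIV I"
  shows "is_ideal (laurent_semiring \<Lambda> \<Delta>) (extended_ideal \<Lambda> \<Delta> I)"
proof -
  have "0 \<in> I" using is_ideal_zero[OF assms] by simp
  then have "0 \<in> extended_ideal \<Lambda> \<Delta> I"
    by (auto simp: extended_ideal_def laurent_semiring_closed)
  moreover have "f + g \<in> extended_ideal \<Lambda> \<Delta> I"
    if "f \<in> extended_ideal \<Lambda> \<Delta> I" "g \<in> extended_ideal \<Lambda> \<Delta> I" for f g
    using that assms
    by (auto simp: extended_ideal_def laurent_semiring_closed lookup_add is_ideal_def image_subset_iff)
  moreover have "h * f \<in> extended_ideal \<Lambda> \<Delta> I"
    if "h \<in> laurent_semiring \<Lambda> \<Delta>" "f \<in> extended_ideal \<Lambda> \<Delta> I" for h f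
  proof -
    have "lookup (h * f) e \<in> I" for e
      unfolding lookup_times
    proof (rule is_ideal_sum[OF assms])
      fix c assume "c \<in> keys h \<times> keys f"
      show "(case c of (a, b) \<Rightarrow> lookup h a * lookup f b when a + b = e) \<in> I"
        using that(2) assms \<open>0 \<in> I\<close>
        by (auto simp: extended_ideal_def is_ideal_def when_def image_subset_iff split: prod.splits)
    qed simp
    then show ?thesis using that laurent_semiring_closed(4)[of h _ _ f] by (auto simp: extended_ideal_def)
  qed
  ultimately show ?thesis by (auto simp: is_ideal_def extended_ideal_def)
qed

text \<open>
  Gauss's lemma: if neither factor has all coefficients in \<open>P\<close>, consider in each factor the
  exponent of highest weight whose coefficient is outside \<open>P\<close>. By
  \<open>top_coefficient_in_ideal\<close> the product of these two coefficients would be in the prime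
  \<open>P\<close>.
\<close>

lemma is_prime_ideal_extended_ideal:
  fixes P :: "'s::comm_semiring_1 set"
  assumes P: "is_prime_ideal UNIV P" "subtractive_ideal UNIV P"
  shows "is_prime_ideal (laurent_semiring \<Lambda> \<Delta>)
    (extended_ideal \<Lambda> \<Delta> P :: ('i, 's) laurent_poly set)"
  unfolding is_prime_ideal_def
proof (intro conjI ballI impI)
  have ideal: "is_ideal UNIV P" using P(1) by (simp add: is_prime_ideal_def)
  then show "is_ideal (laurent_semiring \<Lambda> \<Delta>) (extended_ideal \<Lambda> \<Delta> P :: ('i, 's) laurent_poly set)"
    by (rule is_ideal_extended_ideal)
  have "(laurent_const 1 :: ('i, 's) laurent_poly) \<notin> extended_ideal \<Lambda> \<Delta> P"
    using is_prime_ideal_one[OF P(1)] laurent_const_in_extended_ideal_iff[OF ideal] by blast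
  then show "extended_ideal \<Lambda> \<Delta> P \<noteq> (laurent_semiring \<Lambda> \<Delta> :: ('i, 's) laurent_poly set)"
    using laurent_semiring_closed(5) by blast
next
  fix f g :: "('i, 's) laurent_poly"
  assume fg: "f \<in> laurent_semiring \<Lambda> \<Delta>" "g \<in> laurent_semiring \<Lambda> \<Delta>" "f * g \<in> extended_ideal \<Lambda> \<Delta> P"
  have ideal: "is_ideal UNIV P" using P(1) by (simp add: is_prime_ideal_def)
  have zero: "0 \<in> P" using is_ideal_zero[OF ideal] by simp
  obtain \<phi> :: "('i \<Rightarrow>\<^sub>0 int) \<Rightarrow> int" where \<phi>: "additive \<phi>" "inj_on \<phi> (keys f \<union> keys g)"
    using additive_functional_inj_on[of "keys f \<union> keys g"] by auto
  have top: "\<exists>e\<in>keys h. lookup h e \<notin> P \<and> (\<forall>e'. \<phi> e < \<phi> e' \<longrightarrow> lookup h e' \<in> P)"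
    if h: "h \<in> laurent_semiring \<Lambda> \<Delta>" "h \<notin> extended_ideal \<Lambda> \<Delta> P" for h :: "('i, 's) laurent_poly"
  proof -
    let ?B = "{e. lookup h e \<notin> P}"
    have keys: "?B \<subseteq> keys h" using zero by (auto simp: in_keys_iff)
    moreover have "?B \<noteq> {}" using h by (auto simp: extended_ideal_def)
    ultimately obtain e where "e \<in> ?B" "\<And>e'. e' \<in> ?B \<Longrightarrow> \<phi> e' \<le> \<phi> e"
      using finite_obtains_maximizer[OF finite_subset[OF keys finite_keys], of \<phi>] by blast
    then show ?thesis using keys by (metis (lifting) leD mem_Collect_eq subsetD)
  qed
  show "f \<in> extended_ideal \<Lambda> \<Delta> P \<or> g \<in> extended_ideal \<Lambda> \<Delta> P"
  proof (rule ccontr)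
    assume "\<not> ?thesis"
    then obtain a b where a: "a \<in> keys f" "lookup f a \<notin> P" "\<And>a'. \<phi> a < \<phi> a' \<Longrightarrow> lookup f a' \<in> P"
      and b: "b \<in> keys g" "lookup g b \<notin> P" "\<And>b'. \<phi> b < \<phi> b' \<Longrightarrow> lookup g b' \<in> P"
      using top[OF fg(1)] top[OF fg(2)] by blast
    have "lookup f a * lookup g b \<in> P"
    proof (rule top_coefficient_in_ideal[OF P(2) \<phi>(1)])
      fix a' b' assume "\<phi> a < \<phi> a' \<or> \<phi> b < \<phi> b'"
      then show "lookup f a' * lookup g b' \<in> P"
        using a(3) b(3) ideal unfolding is_ideal_def by (metis UNIV_I mult.commute)
    qed (use \<phi>(2) a(1) b(1) fg(3) in \<open>auto simp: extended_ideal_def intro: inj_on_subset\<close>)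
    then show False using P(1) a(2) b(2) by (auto simp: is_prime_ideal_def)
  qed
qed

lemma is_prime_ideal_contraction:
  fixes Q :: "('i, 's::comm_semiring_1) laurent_poly set"
  assumes "is_prime_ideal (laurent_semiring \<Lambda> \<Delta>) Q"
  shows "is_prime_ideal UNIV (laurent_const -` Q)"
proof -
  have hom: "laurent_const (a + b) = laurent_const a + (laurent_const b :: ('i, 's) laurent_poly)"
    "laurent_const (a * b) = laurent_const a * (laurent_const b :: ('i, 's) laurent_poly)" for a b
    by (simp_all add: laurent_const_def single_add mult_single)
  have Q: "is_ideal (laurent_semiring \<Lambda> \<Delta>) Q" using assms by (simp add: is_prime_ideal_def)
  have "laurent_const 0 \<in> Q"
    using is_ideal_zero[OF Q laurent_semiring_closed(1)] by (simp add: laurent_const_def)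
  moreover have "laurent_const 1 \<notin> Q"
    using is_prime_ideal_one[OF assms] by (simp add: laurent_const_def)
  moreover have "laurent_const s * f \<in> Q" if "f \<in> Q" for s f
    using Q that laurent_semiring_closed(5) unfolding is_ideal_def by blast
  moreover have "f + g \<in> Q" if "f \<in> Q" "g \<in> Q" for f g
    using Q that by (simp add: is_ideal_def)
  ultimately have "is_ideal UNIV (laurent_const -` Q)"
    by (auto simp: is_ideal_def hom)
  moreover have "laurent_const -` Q \<noteq> UNIV"
    using \<open>laurent_const 1 \<notin> Q\<close> by blast
  moreover have "a \<in> laurent_const -` Q \<or> b \<in> laurent_const -` Q" if "a * b \<in> laurent_const -` Q" for a b
    using assms that laurent_semiring_closed(5) unfolding is_prime_ideal_def
    by (metis hom(2) vimage_eq)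
  ultimately show ?thesis unfolding is_prime_ideal_def by blast
qed

section \<open>Few zero-divisors\<close>

lemma few_zero_divisors_laurent_if:
  fixes \<Lambda> \<Delta> :: "'i set"
  assumes S: "subtractive_semiring (UNIV :: 's::comm_semiring_1 set)"
    and zd: "few_zero_divisors_degree (UNIV :: 's set) n"
    and A: "property_A (UNIV :: 's set)"
  shows "few_zero_divisors_degree (laurent_semiring \<Lambda> \<Delta> :: ('i, 's) laurent_poly set) n"
proof -
  obtain p :: "nat \<Rightarrow> 's set" where p: "\<forall>i\<in>{1..n}. is_prime_ideal UNIV (p i)"
    and Z: "zero_divisors UNIV = (\<Union>i\<in>{1..n}. p i)"
    and irr: "\<forall>i\<in>{1..n}. \<not> p i \<subseteq> (\<Union>j\<in>{1..n} - {i}. p j)"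
    using zd unfolding few_zero_divisors_degree_def by (elim exE conjE) (rule that)
  note p = bspec[OF p] and irr = bspec[OF irr]
  have ideal: "is_ideal UNIV (p i)" if "i \<in> {1..n}" for i
    using p[OF that] by (simp add: is_prime_ideal_def)
  then have sub: "subtractive_ideal UNIV (p i)" if "i \<in> {1..n}" for i
    using S that by (simp add: subtractive_semiring_def)
  let ?E = "\<lambda>i. extended_ideal \<Lambda> \<Delta> (p i) :: ('i, 's) laurent_poly set"
  have "f \<in> zero_divisors (laurent_semiring \<Lambda> \<Delta>) \<longleftrightarrow> (\<exists>i\<in>{1..n}. f \<in> ?E i)" for f
  proof
    assume "f \<in> zero_divisors (laurent_semiring \<Lambda> \<Delta>)"
    then obtain s where f: "f \<in> laurent_semiring \<Lambda> \<Delta>" and s: "s \<noteq> 0" "range (lookup f) \<subseteq> annihilator s"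
      by (auto simp: zero_divisors_laurent_semiring)
    have "\<exists>i\<in>{1..n}. annihilator s \<subseteq> p i"
      using annihilator_subset_zero_divisors[OF s(1)] p sub
      by (intro prime_avoidance is_ideal_annihilator) (auto simp: Z)
    then show "\<exists>i\<in>{1..n}. f \<in> ?E i" using f s(2) unfolding extended_ideal_def by blast
  next
    assume "\<exists>i\<in>{1..n}. f \<in> ?E i"
    then obtain i where i: "i \<in> {1..n}" and f: "f \<in> laurent_semiring \<Lambda> \<Delta>" "range (lookup f) \<subseteq> p i"
      by (auto simp: extended_ideal_def)
    let ?F = "lookup f ` keys f"
    have "ideal_generated UNIV ?F \<subseteq> p i"
      using f(2) by (intro ideal_generated_subset ideal i) auto
    also have "\<dots> \<subseteq> zero_divisors UNIV" using i Z by blast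
    finally obtain s where s: "s \<noteq> 0" "\<forall>a\<in>ideal_generated UNIV ?F. s * a = 0"
      using A unfolding property_A_def by (metis finite_imageI finite_keys subset_UNIV)
    have "s * lookup f e = 0" for e
      using s(2) subset_ideal_generated[of ?F UNIV]
      by (cases "e \<in> keys f") (blast, simp add: in_keys_iff)
    then show "f \<in> zero_divisors (laurent_semiring \<Lambda> \<Delta>)"
      using f(1) s(1) by (auto simp: zero_divisors_laurent_semiring annihilator_def)
  qed
  then have "zero_divisors (laurent_semiring \<Lambda> \<Delta>) = (\<Union>i\<in>{1..n}. ?E i)" by blast
  moreover have "\<not> ?E i \<subseteq> (\<Union>j\<in>{1..n} - {i}. ?E j)" if i: "i \<in> {1..n}" for i
  proof
    assume *: "?E i \<subseteq> (\<Union>j\<in>{1..n} - {i}. ?E j)"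
    have "p i \<subseteq> (\<Union>j\<in>{1..n} - {i}. p j)"
    proof
      fix s assume "s \<in> p i"
      then have "laurent_const s \<in> ?E i"
        by (rule laurent_const_in_extended_ideal_iff[OF ideal[OF i], THEN iffD2])
      then obtain j where j: "j \<in> {1..n} - {i}" "laurent_const s \<in> ?E j" using * by blast
      then have "is_ideal UNIV (p j)" by (intro ideal) blast
      then have "s \<in> p j" using j(2) by (rule laurent_const_in_extended_ideal_iff[THEN iffD1])
      then show "s \<in> (\<Union>j\<in>{1..n} - {i}. p j)" using j(1) by blast
    qed
    then show False using irr[OF i] by blast
  qed
  moreover have "is_prime_ideal (laurent_semiring \<Lambda> \<Delta>) (?E i)" if "i \<in> {1..n}" for i
    by (rule is_prime_ideal_extended_ideal[OF p[OF that] sub[OF that]])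
  ultimately show ?thesis unfolding few_zero_divisors_degree_def by (intro exI[of _ ?E]) blast
qed

text \<open>
  The powers of one \<open>X\<^sub>\<lambda>\<close>, or of one \<open>X\<^sub>\<delta>\<^sup>-\<^sup>1\<close>. They provide enough distinct monomials
  to pack any finite set of elements of \<open>S\<close> into the coefficients of a single Laurent polynomial.
\<close>

lemma monomials_injective_family:
  fixes \<Lambda> \<Delta> :: "'i set"
  assumes "\<Lambda> \<noteq> {} \<or> \<Delta> \<noteq> {}"
  shows "\<exists>e :: nat \<Rightarrow> 'i \<Rightarrow>\<^sub>0 int. inj e \<and>
    (\<forall>k. Poly_Mapping.single (e k) 1 \<in> (laurent_semiring \<Lambda> \<Delta> :: ('i, 's::comm_semiring_1) laurent_poly set))"
proof -
  obtain i and c :: int where ic: "c \<noteq> 0"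
    "Poly_Mapping.single (Poly_Mapping.single i c) 1 \<in> (laurent_semiring \<Lambda> \<Delta> :: ('i, 's) laurent_poly set)"
  proof (cases "\<Lambda> = {}")
    case False
    then obtain i where "i \<in> \<Lambda>" by blast
    then have "laurent_var i \<in> (laurent_semiring \<Lambda> \<Delta> :: ('i, 's) laurent_poly set)"
      unfolding laurent_semiring_def by (blast intro: subsemiring_generated.generator)
    then show ?thesis using that[of 1 i] by (simp add: laurent_var_def)
  next
    case True
    then obtain i where "i \<in> \<Delta>" using assms by blast
    then have "laurent_var_inv i \<in> (laurent_semiring \<Lambda> \<Delta> :: ('i, 's) laurent_poly set)"
      unfolding laurent_semiring_def by (blast intro: subsemiring_generated.generator)
    then show ?thesis using that[of "-1" i] by (simp add: laurent_var_inv_def)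
  qed
  let ?e = "\<lambda>k::nat. Poly_Mapping.single i (int k * c)"
  have "Poly_Mapping.single (?e k) 1 \<in> (laurent_semiring \<Lambda> \<Delta> :: ('i, 's) laurent_poly set)" for k
  proof (induction k)
    case 0
    then show ?case by (simp add: laurent_semiring_closed)
  next
    case (Suc k)
    have "Poly_Mapping.single (?e (Suc k)) (1::'s) =
        Poly_Mapping.single (Poly_Mapping.single i c) 1 * Poly_Mapping.single (?e k) 1"
      by (simp add: mult_single distrib_right flip: single_add)
    then show ?case using laurent_semiring_closed(4)[OF ic(2) Suc] by simp
  qed
  moreover have "inj ?e"
  proof (rule injI)
    fix k l assume "?e k = ?e l"
    then have "lookup (?e k) i = lookup (?e l) i" by simp
    then show "k = l" using ic(1) by simp
  qed
  ultimately show ?thesis by (intro exI[of _ ?e]) blast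
qed

lemma few_zero_divisors_laurent_only_if:
  fixes \<Lambda> \<Delta> :: "'i set"
  assumes S: "subtractive_semiring (UNIV :: 's::comm_semiring_1 set)"
    and nonempty: "\<Lambda> \<noteq> {} \<or> \<Delta> \<noteq> {}"
    and zd: "few_zero_divisors_degree (laurent_semiring \<Lambda> \<Delta> :: ('i, 's) laurent_poly set) n"
  shows "few_zero_divisors_degree (UNIV :: 's set) n" and "property_A (UNIV :: 's set)"
proof -
  let ?R = "laurent_semiring \<Lambda> \<Delta> :: ('i, 's) laurent_poly set"
  obtain Q :: "nat \<Rightarrow> ('i, 's) laurent_poly set"
    where Q: "\<forall>i\<in>{1..n}. is_prime_ideal ?R (Q i)"
    and ZR: "zero_divisors ?R = (\<Union>i\<in>{1..n}. Q i)"
    and irr: "\<forall>i\<in>{1..n}. \<not> Q i \<subseteq> (\<Union>j\<in>{1..n} - {i}. Q j)"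
    using zd unfolding few_zero_divisors_degree_def by (elim exE conjE) (rule that)
  note Q = bspec[OF Q] and irr = bspec[OF irr]
  define p where "p i = laurent_const -` Q i" for i
  have p: "is_prime_ideal UNIV (p i)" if "i \<in> {1..n}" for i
    unfolding p_def by (rule is_prime_ideal_contraction[OF Q[OF that]])
  have sub: "subtractive_ideal UNIV (p i)" if "i \<in> {1..n}" for i
    using S p[OF that] by (simp add: subtractive_semiring_def is_prime_ideal_def)
  have ZS: "zero_divisors UNIV = (\<Union>i\<in>{1..n}. p i)"
    using laurent_const_zero_divisor_iff[where 'i = 'i and 's = 's and \<Lambda> = \<Lambda> and \<Delta> = \<Delta>]
    by (auto simp: ZR p_def)
  have avoid: "\<exists>i\<in>{1..n}. I \<subseteq> p i" if "is_ideal UNIV I" "I \<subseteq> zero_divisors UNIV" for I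
    by (rule prime_avoidance[OF _ that(1)]) (use that(2) ZS p sub in auto)
  have into_Q: "f \<in> Q i" if "i \<in> {1..n}" "f \<in> ?R" "range (lookup f) \<subseteq> p i" for f i
    using Q[OF that(1)] that(2,3) unfolding p_def is_prime_ideal_def
    by (blast intro: coefficients_in_ideal)

  show "few_zero_divisors_degree (UNIV :: 's set) n"
    unfolding few_zero_divisors_degree_def
  proof (intro exI[of _ p] conjI ballI notI)
    fix i assume i: "i \<in> {1..n}" and "p i \<subseteq> (\<Union>j\<in>{1..n} - {i}. p j)"
    then have "\<exists>j\<in>{1..n} - {i}. p i \<subseteq> p j"
      using p sub by (intro prime_avoidance) (auto simp: is_prime_ideal_def)
    then obtain j where j: "j \<in> {1..n}" "j \<noteq> i" "p i \<subseteq> p j" by blast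
    obtain f where f: "f \<in> Q i" "\<And>j. j \<in> {1..n} \<Longrightarrow> j \<noteq> i \<Longrightarrow> f \<notin> Q j" using irr[OF i] by blast
    then have "f \<in> zero_divisors ?R" using ZR i by blast
    then obtain s where fR: "f \<in> ?R" and s: "s \<noteq> 0" "range (lookup f) \<subseteq> annihilator s"
      by (auto simp: zero_divisors_laurent_semiring)
    obtain k where k: "k \<in> {1..n}" "annihilator s \<subseteq> p k"
      using avoid[OF is_ideal_annihilator annihilator_subset_zero_divisors[OF s(1)]] by blast
    then have "f \<in> Q k" using into_Q fR s(2) by blast
    then have "k = i" using f(2) k(1) by blast
    then have "f \<in> Q j" using into_Q[OF j(1) fR] s(2) k(2) j(3) by blast
    then show False using f(2) j by blast
  qed (use p ZS in auto)

  show "property_A (UNIV :: 's set)"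
    unfolding property_A_def
  proof (intro allI impI)
    fix F :: "'s set"
    assume F: "finite F \<and> F \<subseteq> UNIV \<and> ideal_generated UNIV F \<subseteq> zero_divisors UNIV"
    obtain i where i: "i \<in> {1..n}" "ideal_generated UNIV F \<subseteq> p i"
      using avoid[OF is_ideal_ideal_generated] F by blast
    obtain e :: "nat \<Rightarrow> 'i \<Rightarrow>\<^sub>0 int" where e: "inj e" "\<And>k. Poly_Mapping.single (e k) 1 \<in> ?R"
      using monomials_injective_family[OF nonempty] by blast
    obtain h :: "'s \<Rightarrow> nat" where h: "inj_on h F"
      using F finite_imp_inj_to_nat_seg by metis
    define f :: "('i, 's) laurent_poly"
      where "f = (\<Sum>a\<in>F. Poly_Mapping.single (e (h a)) 1 * laurent_const a)"
    have "f \<in> Q i"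
      unfolding f_def
    proof (rule is_ideal_sum)
      show ideal: "is_ideal ?R (Q i)" using Q[OF i(1)] by (simp add: is_prime_ideal_def)
      fix a assume "a \<in> F"
      then have "laurent_const a \<in> Q i" using i(2) subset_ideal_generated[of F UNIV] by (auto simp: p_def)
      then show "Poly_Mapping.single (e (h a)) 1 * laurent_const a \<in> Q i"
        using ideal e(2) by (auto simp: is_ideal_def)
    qed (rule laurent_semiring_closed)
    then have "f \<in> zero_divisors ?R" using ZR i(1) by blast
    then obtain s where s: "s \<noteq> 0" "range (lookup f) \<subseteq> annihilator s"
      by (auto simp: zero_divisors_laurent_semiring)
    have "a \<in> annihilator s" if a: "a \<in> F" for a
    proof -
      have "lookup f (e (h a)) = (\<Sum>b\<in>F. if b = a then b else 0)"
        unfolding f_def laurent_const_def mult_single lookup_sum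
        using a h e(1) by (intro sum.cong) (auto simp: lookup_single when_def inj_on_eq_iff inj_eq)
      then have "lookup f (e (h a)) = a" using a F by simp
      then show ?thesis using s(2) by (metis rangeI subsetD)
    qed
    then have "ideal_generated UNIV F \<subseteq> annihilator s"
      by (intro ideal_generated_subset is_ideal_annihilator) blast
    then show "\<exists>s\<in>UNIV. s \<noteq> 0 \<and> (\<forall>a\<in>ideal_generated UNIV F. s * a = 0)"
      using s(1) by (auto simp: annihilator_def)
  qed
qed

theorem corollary60:
  fixes \<Lambda> \<Delta> :: "'i set"
  assumes "subtractive_semiring (UNIV :: 's::comm_semiring_1 set)"
    and "\<Lambda> \<noteq> {} \<or> \<Delta> \<noteq> {}"
  shows "\<forall>n::nat. n \<ge> 1 \<longrightarrow>
    (few_zero_divisors_degree (laurent_semiring \<Lambda> \<Delta> :: ('i, 's) laurent_poly set) n \<longleftrightarrow>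
     few_zero_divisors_degree (UNIV :: 's set) n \<and> property_A (UNIV :: 's set))"
  using few_zero_divisors_laurent_if[OF assms(1), of _ \<Lambda> \<Delta>]
    few_zero_divisors_laurent_only_if[OF assms] by (intro allI impI iffI conjI) simp_all

end
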